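(* Let $m\ge 3$ and $n\ge 6m+1$ be integers, and consider a polynomial $$f(z):=z^{\binom{n}{m}}+\sum_{k=0}^{n-1}a_{k}z^{b_{k}},$$ where the numbers $a_k\in\mathbb{C}$ and the integers $b_k\ge 0$ satisfy $$|a_{k}|\le \binom{n}{k},\qquad 0\le b_{k}\le \frac{k}{n-m}\binom{n-1}{m}\qquad\text{for } k\in\{0,1,\ldots,n-1\}.$$ Then all (complex) roots of the polynomial $f(z)$ lie in the disc defined by $$|z|<1+\frac{m!}{(n-m)^{m-2}}.$$ *)

theory Defs
  imports Complex_Main "HOL-Computational_Algebra.Polynomial"
begin

end

theory Submission
  imports Defs
begin

text \<open>
  Put \<open>t = (n-1 choose m) / (n-m)\<close>, so that \<open>n choose m = n t\<close> and \<open>b\<^sub>k \<le> k t\<close>. If \<open>r = |z| \<ge> 1\<close>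
  and \<open>y = r\<^sup>t\<close>, then \<open>f(z) = 0\<close> forces \<open>y^n \<le> (\<Sum>k<n. (n choose k) y^k) = (1+y)^n - y^n\<close>, which
  is impossible once \<open>y \<ge> 2n\<close>. For \<open>r \<ge> 1 + \<delta>\<close> with \<open>\<delta> = m!/(n-m)^(m-2)\<close> one has \<open>t \<delta> \<ge> n - m\<close>,
  and Bernoulli's inequality for the exponent \<open>t/2\<close> gives \<open>y \<ge> (1 + (n-m)/2)\<^sup>2 \<ge> 2n\<close>.
\<close>

text \<open>The difference \<open>(1 + u) powr p - p * u\<close> has derivative
  \<open>p * ((1 + u) powr (p - 1) - 1)\<close>, nonnegative for \<open>u \<ge> 0\<close>. A real
  exponent is needed because \<open>t / 2\<close> need not be an integer.\<close>

lemma Bernoulli_inequality_powr: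
  fixes x p :: real
  assumes "x \<ge> 0" "p \<ge> 1"
  shows "1 + p * x \<le> (1 + x) powr p"
proof -
  have "(1 + 0) powr p - p * 0 \<le> (1 + x) powr p - p * x"
  proof (rule deriv_nonneg_imp_mono[where g = "\<lambda>u. (1 + u) powr p - p * u" and a = 0 and b = x])
    fix u :: real assume "u \<in> {0..x}"
    then have u: "0 \<le> u" "u \<le> x" by auto
    show "((\<lambda>u. (1 + u) powr p - p * u) has_real_derivative p * (1 + u) powr (p - 1) - p) (at u)"
      using u by (auto intro!: derivative_eq_intros simp: powr_diff)
    show "p * (1 + u) powr (p - 1) - p \<ge> 0"
      using u assms by (simp add: ge_one_powr_ge_zero)
  qed (use assms in auto)
  then show ?thesis by simp
qed

text \<open>The right side is the product \<open>(s + 1) ... (s + k)\<close>, whose \<open>k\<close>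
  factors all exceed \<open>s\<close>.\<close>

lemma power_le_binomial_mult_fact: "s ^ k \<le> ((s + k) choose k) * fact k"
proof (induction k)
  case (Suc k)
  have "s ^ Suc k \<le> Suc (s + k) * (((s + k) choose k) * fact k)"
    using mult_le_mono[OF _ Suc, of s "Suc (s + k)"] by simp
  also have "\<dots> = (Suc k * (Suc (s + k) choose Suc k)) * fact k"
    by (simp only: Suc_times_binomial mult.assoc)
  finally show ?case by (simp add: algebra_simps)
qed simp

text \<open>Bernoulli's inequality for \<open>(y / (1 + y)) ^ n = (1 - 1 / (1 + y)) ^ n\<close>
  gives at least \<open>1 - n / (1 + y)\<close>, which exceeds \<open>1 / 2\<close> because
  \<open>1 + y > 2 * n\<close>.\<close>

lemma one_plus_power_less_twice_power:
  fixes y :: real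
  assumes "y \<ge> 2 * real n" "n > 0"
  shows "(1 + y) ^ n < 2 * y ^ n"
proof -
  have y: "y > 0" using assms by linarith
  have "1 / 2 < 1 + real n * (- 1 / (1 + y))"
    using assms y by (simp add: field_simps)
  also have "\<dots> \<le> (1 + (- 1 / (1 + y))) ^ n"
    by (rule Bernoulli_inequality) (use y in \<open>simp add: field_simps\<close>)
  also have "1 + (- 1 / (1 + y)) = y / (1 + y)"
    using y by (simp add: field_simps)
  finally show ?thesis using y by (simp add: power_divide field_simps)
qed

text \<open>Since \<open>cmod z \<ge> 1\<close>, raising each exponent \<open>b k\<close> to
  \<open>k * t\<close> only enlarges the bound, while \<open>N = n * t\<close> makes the leading
  term exactly \<open>y ^ n\<close>.\<close>

lemma root_of_dominated_poly:
  fixes n N :: nat and a :: "nat \<Rightarrow> complex" and b :: "nat \<Rightarrow> nat" and t :: real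
  assumes a: "\<And>k. k < n \<Longrightarrow> cmod (a k) \<le> real (n choose k)"
    and b: "\<And>k. k < n \<Longrightarrow> real (b k) \<le> real k * t"
    and N: "real N = real n * t"
    and root: "z ^ N + (\<Sum>k<n. a k * z ^ b k) = 0"
    and z: "cmod z \<ge> 1"
  shows "2 * (cmod z powr t) ^ n \<le> (1 + cmod z powr t) ^ n"
proof -
  define y where "y = cmod z powr t"
  have z0: "cmod z > 0" using z by linarith
  then have "y > 0" by (auto simp: y_def)
  then have pow: "y ^ k = cmod z powr (real k * t)" for k
    by (simp add: y_def powr_powr mult.commute flip: powr_realpow)
  have "y ^ n = cmod (z ^ N)"
    using z0 by (simp add: pow norm_power powr_realpow flip: N)
  also have "\<dots> = cmod (\<Sum>k<n. a k * z ^ b k)"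
    using root by (metis add_eq_0_iff norm_minus_cancel)
  also have "\<dots> \<le> (\<Sum>k<n. real (n choose k) * y ^ k)"
  proof (rule sum_norm_le)
    fix k assume "k \<in> {..<n}"
    then have k: "k < n" by simp
    have "cmod z ^ b k = cmod z powr real (b k)"
      using z0 by (simp add: powr_realpow)
    also have "\<dots> \<le> y ^ k"
      unfolding pow by (rule powr_mono) (use b[OF k] z in auto)
    finally show "cmod (a k * z ^ b k) \<le> real (n choose k) * y ^ k"
      by (auto simp: norm_mult norm_power intro!: mult_mono a k)
  qed
  also have "\<dots> = (1 + y) ^ n - y ^ n"
    using binomial_ring[of y 1 n] by (simp add: add.commute lessThan_Suc_atMost[symmetric])
  finally show ?thesis by (simp add: y_def)
qed

theorem proposition5p1:
  fixes m n :: nat and a :: "nat \<Rightarrow> complex" and b :: "nat \<Rightarrow> nat"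
    and f :: "complex poly"
  assumes "m \<ge> 3"
    and "n \<ge> 6 * m + 1"
    and "f = monom 1 (n choose m) + (\<Sum>k = 0..n - 1. monom (a k) (b k))"
    and "\<And>k. k \<in> {0..n - 1} \<Longrightarrow> cmod (a k) \<le> real (n choose k)"
    and "\<And>k. k \<in> {0..n - 1} \<Longrightarrow>
           real (b k) \<le> real k / (real n - real m) * real ((n - 1) choose m)"
  shows "\<forall>z. poly f z = 0 \<longrightarrow> cmod z < 1 + fact m / (real n - real m) ^ (m - 2)"
proof (intro allI impI, rule ccontr)
  fix z assume root: "poly f z = 0"
  define s where "s = n - m"
  define \<delta> :: real where "\<delta> = fact m / real s ^ (m - 2)"
  define t where "t = real ((n - 1) choose m) / real s"
  assume "\<not> cmod z < 1 + fact m / (real n - real m) ^ (m - 2)"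
  moreover have s_eq: "real n - real m = real s"
    using assms(1,2) by (simp add: s_def)
  ultimately have z: "cmod z \<ge> 1 + \<delta>" by (simp add: \<delta>_def)
  have s: "n = s + m" "s \<ge> 5 * m + 1" "s \<ge> 16" using assms(1,2) by (auto simp: s_def)
  have \<delta>: "\<delta> \<ge> 0" by (simp add: \<delta>_def)
  obtain p where p: "m = Suc (Suc p)"
    using assms(1) that[of "m - 2"] by simp
  have n1: "n - 1 = s + Suc p" using s p by simp
  have set: "{0..n - 1} = {..<n}" using s by auto

  have "real s * (real n * t) = real (n * ((n - 1) choose m))"
    using s by (simp add: t_def)
  also have "n * ((n - 1) choose m) = s * (n choose m)"
    using binomial_absorb_comp[of n m] by (simp add: s_def)
  finally have N: "real (n choose m) = real n * t" using s by simp

  \<comment> \<open>Absorption turns \<open>t\<close> into \<open>(n - 1 choose m - 1) / m\<close>,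
    the form used in both lower bounds below; \<open>Suc p\<close> is \<open>m - 1\<close>.\<close>
  obtain q where q: "s = Suc q"
    using s(3) that[of "s - 1"] by simp
  have "n - 1 = Suc (Suc p + q)" using n1 q by simp
  then have "m * ((n - 1) choose m) = s * ((n - 1) choose Suc p)"
    unfolding p q by (metis Suc_times_binomial_add)
  then have "real m * real ((n - 1) choose m) = real s * real ((n - 1) choose Suc p)"
    by (metis of_nat_mult)
  then have t: "t = real ((n - 1) choose Suc p) / real m"
    using s assms(1) by (simp add: t_def field_simps)

  \<comment> \<open>The base 6 comes from \<open>n - 1 \<ge> 6 * m\<close>. The goal
    \<open>t \<ge> 2\<close> makes \<open>t / 2\<close> an admissible Bernoulli exponent.\<close>
  have "2 * real m \<le> 1 + real (Suc p) * 5" using p by simp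
  also have "\<dots> \<le> (1 + 5) ^ Suc p" by (rule Bernoulli_inequality) simp
  also have "\<dots> \<le> (real (n - 1) / real (Suc p)) ^ Suc p"
    using assms(2) p by (intro power_mono) (simp_all add: field_simps)
  also have "\<dots> \<le> real ((n - 1) choose Suc p)"
    by (rule binomial_ge_n_over_k_pow_k) (use n1 in simp)
  finally have t2: "t / 2 \<ge> 1" using assms(1) by (simp add: t field_simps)

  have "m - 2 = p" "fact m = real m * fact (Suc p)"
    by (simp_all add: p)
  then have \<delta>': "\<delta> = real m * fact (Suc p) / real s ^ p"
    by (simp only: \<delta>_def)
  have "real s * real s ^ p = real (s ^ Suc p)" by simp
  also have "\<dots> \<le> real (((n - 1) choose Suc p) * fact (Suc p))"
    unfolding n1 of_nat_le_iff by (rule power_le_binomial_mult_fact)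
  also have "\<dots> = t * \<delta> * real s ^ p"
    using s assms(1) unfolding t \<delta>' by (simp del: fact_Suc binomial_Suc_Suc)
  finally have t\<delta>: "real s \<le> t * \<delta>" using s by simp

  \<comment> \<open>Bernoulli with exponent \<open>t\<close> would only give \<open>1 + s\<close>,
    short of \<open>2 * n\<close>; halving the exponent and squaring gives a bound quadratic in
    \<open>s\<close>.\<close>
  have "2 * real n \<le> 5 * real s" using s by simp
  also have "\<dots> \<le> (1 + real s / 2)\<^sup>2"
  proof -
    \<comment> \<open>After expanding the square, \<open>4 * s \<le> 1 + s * s / 4\<close> remains;
      \<open>s \<ge> 16\<close> suffices.\<close>
    have "16 * real s \<le> real s * real s"
      using s by (intro mult_right_mono) auto
    then show ?thesis
      by (simp only: power2_eq_square) (simp add: field_simps)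
  qed
  also have "\<dots> \<le> (1 + t / 2 * \<delta>)\<^sup>2"
    using t\<delta> by (intro power_mono) simp_all
  also have "\<dots> \<le> ((1 + \<delta>) powr (t / 2))\<^sup>2"
    using Bernoulli_inequality_powr[OF \<delta> t2] \<delta> t2 by (intro power_mono) simp_all
  also have "\<dots> = (1 + \<delta>) powr t"
    by (simp add: power2_eq_square flip: powr_add)
  also have "\<dots> \<le> cmod z powr t"
    using z \<delta> t2 by (intro powr_mono2) simp_all
  finally have "(1 + cmod z powr t) ^ n < 2 * (cmod z powr t) ^ n"
    using s by (intro one_plus_power_less_twice_power) auto
  moreover have "2 * (cmod z powr t) ^ n \<le> (1 + cmod z powr t) ^ n"
  proof (rule root_of_dominated_poly[OF _ _ N])
    show "cmod (a k) \<le> real (n choose k)" if "k < n" for k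
      using assms(4)[of k] that unfolding set by simp
    show "real (b k) \<le> real k * t" if "k < n" for k
      using assms(5)[of k] that unfolding set s_eq by (simp add: t_def)
    show "z ^ (n choose m) + (\<Sum>k<n. a k * z ^ b k) = 0"
      using root unfolding assms(3) set by (simp add: poly_monom poly_sum)
    show "cmod z \<ge> 1" using z \<delta> by simp
  qed
  ultimately show False by simp
qed

end
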